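(* Let $\alpha>1$ be a real number and let $m_1,m_\alpha$ be real numbers with $m_1>0$ and $m_\alpha>m_1^\alpha$. For each $\eta\in(0,1)$ let $q_\eta^*$ be an optimal solution (minimizer) and $C_\eta^*$ the optimal value of $$\min_{q\ge 0}\left((1-\eta)q+\sup_{F\in\mathcal F_{1,\alpha}}\mathbb E_F[\tilde d-q]_+\right).$$ Then for each $\eta\in(0,1)$, $q_\eta^*$ is also optimal for the standard newsvendor problem $$\min_{q\ge 0}\left((1-\eta)q+\mathbb E_{F^*}[\tilde d^*-q]_+\right)$$ with demand $\tilde d^*\sim F^*$, and $$q_\eta^*\sim\frac{\alpha-1}{\alpha}\,\frac{1}{1-\eta}\,C_\eta^*\qquad\text{as }\eta\to 1,$$ i.e. the ratio of the two sides tends to $1$ as $\eta\uparrow 1$.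
   Context: $\mathcal F_{1,\alpha}$ denotes the set of all Borel probability distributions $F$ on $[0,\infty)$ with $\int_0^\infty w\,dF(w)=m_1$ and $\int_0^\infty w^\alpha\,dF(w)=m_\alpha$. For $F\in\mathcal F_{1,\alpha}$, $\tilde d$ denotes a random variable with distribution $F$, and $\mathbb E_F[\tilde d-q]_+=\int_0^\infty \max(0,w-q)\,dF(w)$. $F^*$ denotes the distribution function of a non-negative random variable $\tilde d^*$ such that $\mathbb E_{F^*}[\tilde d^*-q]_+=\sup_{F\in\mathcal F_{1,\alpha}}\mathbb E_F[\tilde d-q]_+$ for all $q\ge 0$; such a distribution exists and is unique, given by $F^*(q)=1+\Pi'_+(q)$ for $q\ge0$, where $\Pi'_+$ is the right derivative of the convex function $\Pi(q)=\sup_{F\in\mathcal F_{1,\alpha}}\mathbb E_F[\tilde d-q]_+$. *)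

theory Defs
  imports "HOL-Probability.Probability" "HOL-Library.Landau_Symbols"
begin

text \<open>
  A distribution on $[0,\infty)$ is a Borel probability measure on the whole real line
  (locale \<^locale>\<open>real_distribution\<close>) that gives full mass to $[0,\infty)$.  Integrability is
  required explicitly because the Bochner integral of a non-integrable function is $0$.
\<close>

definition nonneg_distribution :: "real measure \<Rightarrow> bool" where
  "nonneg_distribution F \<longleftrightarrow> real_distribution F \<and> (AE w in F. 0 \<le> w)"

definition ambiguity_set :: "real \<Rightarrow> real \<Rightarrow> real \<Rightarrow> real measure set" where
  "ambiguity_set \<alpha> m1 m\<alpha> =
     {F. nonneg_distribution F
       \<and> integrable F (\<lambda>w. w) \<and> (\<integral>w. w \<partial>F) = m1
       \<and> integrable F (\<lambda>w. w powr \<alpha>) \<and> (\<integral>w. w powr \<alpha> \<partial>F) = m\<alpha>}"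

definition expected_excess :: "real measure \<Rightarrow> real \<Rightarrow> real" where
  "expected_excess F q = (\<integral>w. max 0 (w - q) \<partial>F)"

text \<open>
  For $\alpha > 1$, $m_1 > 0$ and $m_\alpha > m_1^\alpha$ the ambiguity set is nonempty, and for
  $q \ge 0$ the values are bounded by $m_1$, so the real-valued supremum is the true one.
\<close>

definition worst_case_excess :: "real \<Rightarrow> real \<Rightarrow> real \<Rightarrow> real \<Rightarrow> real" where
  "worst_case_excess \<alpha> m1 m\<alpha> q = (SUP F \<in> ambiguity_set \<alpha> m1 m\<alpha>. expected_excess F q)"

definition is_worst_case_distribution :: "real \<Rightarrow> real \<Rightarrow> real \<Rightarrow> real measure \<Rightarrow> bool" where
  "is_worst_case_distribution \<alpha> m1 m\<alpha> F \<longleftrightarrow>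
     nonneg_distribution F
     \<and> (\<forall>q\<ge>0. integrable F (\<lambda>w. max 0 (w - q))
            \<and> expected_excess F q = worst_case_excess \<alpha> m1 m\<alpha> q)"

text \<open>
  Exactly one such distribution exists: its distribution function on $[0,\infty)$ is $1$ plus the
  right derivative of the convex function \<^term>\<open>worst_case_excess \<alpha> m1 m\<alpha>\<close>.  It need not belong
  to the ambiguity set.
\<close>

definition worst_case_distribution :: "real \<Rightarrow> real \<Rightarrow> real \<Rightarrow> real measure" where
  "worst_case_distribution \<alpha> m1 m\<alpha> = (THE F. is_worst_case_distribution \<alpha> m1 m\<alpha> F)"

definition robust_cost :: "real \<Rightarrow> real \<Rightarrow> real \<Rightarrow> real \<Rightarrow> real \<Rightarrow> real" where
  "robust_cost \<alpha> m1 m\<alpha> \<eta> q = (1 - \<eta>) * q + worst_case_excess \<alpha> m1 m\<alpha> q"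

definition newsvendor_cost :: "real measure \<Rightarrow> real \<Rightarrow> real \<Rightarrow> real" where
  "newsvendor_cost F \<eta> q = (1 - \<eta>) * q + expected_excess F q"

definition robust_optimal_value :: "real \<Rightarrow> real \<Rightarrow> real \<Rightarrow> real \<Rightarrow> real" where
  "robust_optimal_value \<alpha> m1 m\<alpha> \<eta> = (INF q \<in> {0..}. robust_cost \<alpha> m1 m\<alpha> \<eta> q)"

end

theory Submission
  imports Defs
begin

text \<open>
  Write $\Pi$ for the worst-case excess. It is convex, decreasing, 1-Lipschitz and vanishes at
  infinity, so $1 + \Pi'_+$ is a distribution function. For its law $F^*$, the increments of
  $E[\min(w, t)]$ and of $-\Pi(t)$ are squeezed between the same multiples of the monotone function
  $-\Pi'_+$, hence agree; thus $F^*$ has expected excess $\Pi$, and the two newsvendor problems have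
  the same cost function.

  For the asymptotics, $\Pi(q)\, q^{\alpha - 1}$ converges to a positive constant. The upper bound
  dominates $(w - q)_+$ by a multiple of $w^\alpha$ minus its tangent at $m_1$; the lower bound comes
  from two-point laws with upper atom $\alpha q / (\alpha - 1)$, where that bound is nearly tight. Testing
  optimality of $q^*_\eta$ against $l\, q^*_\eta$ and letting $l \to 1$ then shows
  $(1 - \eta)\, q^*_\eta / \Pi(q^*_\eta) \to \alpha - 1$, which is the claim since
  $C^*_\eta = (1 - \eta)\, q^*_\eta + \Pi(q^*_\eta)$.
\<close>

section \<open>The distribution with a given expected excess\<close>

text \<open>Replaces integration of a derivative: \<open>D\<close> may jump, so \<open>h\<close> is
  controlled through its increments alone.\<close>

lemma eq_if_increment_le:
  fixes h D :: "real \<Rightarrow> real"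
  assumes "a \<le> b"
    and inc: "\<And>x y. a \<le> x \<Longrightarrow> x \<le> y \<Longrightarrow> y \<le> b \<Longrightarrow> \<bar>h y - h x\<bar> \<le> (y - x) * (D y - D x)"
  shows "h b = h a"
proof -
  \<comment> \<open>Summing over the uniform partition of \<open>[a, b]\<close>, the increments of \<open>D\<close> telescope.\<close>
  have bound: "\<bar>h b - h a\<bar> \<le> (b - a) * (D b - D a) / real (Suc n)" for n
  proof -
    define t where "t i = a + real i * ((b - a) / real (Suc n))" for i
    have t_Suc: "t (Suc i) - t i = (b - a) / real (Suc n)" for i
      by (simp add: t_def distrib_right add_divide_distrib)
    have t0: "t 0 = a" and tn: "t (Suc n) = b"
      by (simp_all add: t_def del: of_nat_Suc)
    have step: "\<bar>h (t (Suc i)) - h (t i)\<bar> \<le> (b - a) / real (Suc n) * (D (t (Suc i)) - D (t i))"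
      if "i < Suc n" for i
    proof -
      have "t (Suc i) \<le> t (Suc n)"
        unfolding t_def using that \<open>a \<le> b\<close> by (intro add_left_mono mult_right_mono) auto
      moreover have "a \<le> t i"
        using \<open>a \<le> b\<close> by (simp add: t_def)
      moreover have "t i \<le> t (Suc i)"
        using t_Suc[of i] \<open>a \<le> b\<close> by (smt (verit) divide_nonneg_nonneg of_nat_0_le_iff)
      ultimately show ?thesis
        using inc[of "t i" "t (Suc i)"] tn t_Suc[of i] by simp
    qed
    have "\<bar>h b - h a\<bar> = \<bar>\<Sum>i<Suc n. h (t (Suc i)) - h (t i)\<bar>"
      by (subst sum_lessThan_telescope) (simp only: t0 tn)
    also have "\<dots> \<le> (\<Sum>i<Suc n. \<bar>h (t (Suc i)) - h (t i)\<bar>)"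
      by (rule sum_abs)
    also have "\<dots> \<le> (\<Sum>i<Suc n. (b - a) / real (Suc n) * (D (t (Suc i)) - D (t i)))"
      by (rule sum_mono) (use step in auto)
    also have "\<dots> = (b - a) / real (Suc n) * (D b - D a)"
      by (subst sum_distrib_left[symmetric], subst sum_lessThan_telescope) (simp only: t0 tn)
    finally show ?thesis
      by simp
  qed
  have "(\<lambda>n. (b - a) * (D b - D a) / real (Suc n)) \<longlonglongrightarrow> 0"
    by (rule LIMSEQ_Suc[OF lim_const_over_n])
  then have "\<bar>h b - h a\<bar> \<le> 0"
    by (rule LIMSEQ_le_const) (use bound in auto)
  then show ?thesis by simp
qed

section \<open>Truncated means and the distribution function\<close>

context real_distribution
begin

lemma integrable_min_diff: "integrable M (\<lambda>w. min w s - min w q)"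
  by (rule integrable_const_bound[of _ "\<bar>s - q\<bar>"]) auto

lemma prob_greaterThan: "prob {x<..} = 1 - cdf M x"
proof -
  have "prob (space M - {..x}) = 1 - prob {..x}"
    by (rule prob_compl) simp
  moreover have "space M - {..x} = {x<..}"
    by auto
  ultimately show ?thesis
    by (simp add: cdf_def)
qed

text \<open>Pointwise, \<open>min w s - min w q\<close> lies between \<open>s - q\<close> times the
  indicators of \<open>w > s\<close> and of \<open>w > q\<close>. Differences are used because a
  single \<open>min w s\<close> may fail to be integrable when the left tail is heavy.\<close>

lemma integral_min_diff_bounds:
  assumes "q \<le> s"
  shows "(s - q) * (1 - cdf M s) \<le> (\<integral>w. min w s - min w q \<partial>M)"
    and "(\<integral>w. min w s - min w q \<partial>M) \<le> (s - q) * (1 - cdf M q)"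
proof -
  have int: "integrable M (\<lambda>w. (s - q) * indicator {x<..} w)" for x
    by (intro integrable_mult_right integrable_real_indicator) (auto simp: emeasure_eq_measure)
  have val: "(s - q) * (1 - cdf M x) = (\<integral>w. (s - q) * indicator {x<..} w \<partial>M)" for x
    by (simp add: prob_greaterThan)
  show "(s - q) * (1 - cdf M s) \<le> (\<integral>w. min w s - min w q \<partial>M)"
    unfolding val
    by (rule integral_mono[OF int integrable_min_diff]) (use assms in \<open>auto simp: indicator_def\<close>)
  show "(\<integral>w. min w s - min w q \<partial>M) \<le> (s - q) * (1 - cdf M q)"
    unfolding val
    by (rule integral_mono[OF integrable_min_diff int]) (use assms in \<open>auto simp: indicator_def\<close>)
qed

end

section \<open>Uniqueness of the law with a given excess\<close>

lemma cdf_nonneg_distribution_neg: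
  assumes "nonneg_distribution F" "x < 0"
  shows "cdf F x = 0"
proof -
  interpret real_distribution F
    using assms by (simp add: nonneg_distribution_def)
  have "AE w in F. 0 \<le> w"
    using assms by (simp add: nonneg_distribution_def)
  then have "AE w in F. \<not> w \<le> x"
    by eventually_elim (use assms in simp)
  then have "emeasure F {..x} = 0"
    using emeasure_eq_0_AE[of "\<lambda>w. w \<le> x" F] by (simp add: atMost_def)
  then show ?thesis
    by (simp add: cdf_def measure_def)
qed

text \<open>For either law, the drop of the excess over \<open>[x, s]\<close>, divided by
  \<open>s - x\<close>, lies between \<open>1 - cdf\<close> at \<open>s\<close> and
  \<open>1 - cdf\<close> at \<open>x\<close>. Crossing the lower bound for \<open>F\<close> with the
  upper bound for \<open>G\<close> gives \<open>cdf G x \<le> cdf F s\<close>, and right continuity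
  lets \<open>s\<close> decrease to \<open>x\<close>. Exchanging the roles later gives
  equality.\<close>

lemma cdf_le_if_expected_excess_eq:
  assumes F: "real_distribution F" "\<And>q. q \<ge> 0 \<Longrightarrow> integrable F (\<lambda>w. max 0 (w - q))"
    and G: "real_distribution G" "\<And>q. q \<ge> 0 \<Longrightarrow> integrable G (\<lambda>w. max 0 (w - q))"
    and eq: "\<And>q. q \<ge> 0 \<Longrightarrow> expected_excess F q = expected_excess G q"
    and "x \<ge> 0"
  shows "cdf G x \<le> cdf F x"
proof -
  have diff: "expected_excess H x - expected_excess H s = (\<integral>w. min w s - min w x \<partial>H)"
    if "\<And>q. q \<ge> 0 \<Longrightarrow> integrable H (\<lambda>w. max 0 (w - q))" "x \<le> s" for H and s :: real
  proof -
    have "min w s - min w x = max 0 (w - x) - max 0 (w - s)" for w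
      using that by auto
    then show ?thesis
      unfolding expected_excess_def using that \<open>x \<ge> 0\<close> by simp
  qed
  have le: "cdf G x \<le> cdf F s" if "x < s" for s
  proof -
    have "(s - x) * (1 - cdf F s) \<le> (\<integral>w. min w s - min w x \<partial>F)"
      using that by (intro real_distribution.integral_min_diff_bounds F) auto
    also have "\<dots> = (\<integral>w. min w s - min w x \<partial>G)"
      using diff[OF F(2), of s] diff[OF G(2), of s] eq[of x] eq[of s] that \<open>x \<ge> 0\<close> by simp
    also have "\<dots> \<le> (s - x) * (1 - cdf G x)"
      using that by (intro real_distribution.integral_min_diff_bounds G) auto
    finally show ?thesis
      using that by simp
  qed
  interpret F: real_distribution F by fact
  have "(cdf F \<longlongrightarrow> cdf F x) (at_right x)"
    using F.cdf_is_right_cont by (simp add: continuous_within)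
  then show ?thesis
    by (rule tendsto_lowerbound) (auto simp: eventually_at_right_field intro!: exI[of _ "x + 1"] le)
qed

lemma nonneg_distribution_eqI:
  assumes F: "nonneg_distribution F" "\<And>q. q \<ge> 0 \<Longrightarrow> integrable F (\<lambda>w. max 0 (w - q))"
    and G: "nonneg_distribution G" "\<And>q. q \<ge> 0 \<Longrightarrow> integrable G (\<lambda>w. max 0 (w - q))"
    and eq: "\<And>q. q \<ge> 0 \<Longrightarrow> expected_excess F q = expected_excess G q"
  shows "F = G"
proof -
  have FG: "real_distribution F" "real_distribution G"
    using F G by (auto simp: nonneg_distribution_def)
  have "cdf F x = cdf G x" for x
  proof (cases "x < 0")
    case True
    then show ?thesis
      using F G by (simp add: cdf_nonneg_distribution_neg)
  next
    case False
    then show ?thesis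
      using cdf_le_if_expected_excess_eq[of F G x] cdf_le_if_expected_excess_eq[of G F x]
        F G FG eq by (simp add: order_antisym)
  qed
  then show ?thesis
    using FG cdf_unique by blast
qed

text \<open>Convexity makes the right derivative monotone, the Lipschitz bound and antitonicity keep
  one plus it in \<open>[0, 1]\<close>, and the limit at infinity identifies the mean as
  \<open>P 0\<close>.\<close>

lemma exists_distribution_with_excess:
  fixes P :: "real \<Rightarrow> real"
  assumes convex: "convex_on {0..} P"
    and anti: "\<And>x y. 0 \<le> x \<Longrightarrow> x \<le> y \<Longrightarrow> P y \<le> P x"
    and lip: "\<And>x y. 0 \<le> x \<Longrightarrow> x \<le> y \<Longrightarrow> P x - P y \<le> y - x"
    and lim: "(P \<longlongrightarrow> 0) at_top"
  shows "\<exists>F. nonneg_distribution F \<and>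
    (\<forall>q\<ge>0. integrable F (\<lambda>w. max 0 (w - q)) \<and> expected_excess F q = P q)"
proof -
  define S where "S x y = (P y - P x) / (y - x)" for x y
  \<comment> \<open>An infimum instead of a limit: it exists because the slopes are bounded below,
    and \<open>D_le\<close> is immediate. Convexity enters in the reverse comparison
    \<open>S_le_D\<close>.\<close>
  define D where "D x = (INF y\<in>{x<..}. S x y)" for x
  have S_ge: "-1 \<le> S x y" and S_le: "S x y \<le> 0" if "0 \<le> x" "x < y" for x y
    using lip[of x y] anti[of x y] that by (auto simp: S_def field_simps)
  have bdd: "bdd_below (S x ` {x<..})" if "0 \<le> x" for x
    using S_ge that by (intro bdd_belowI[of _ "-1"]) auto
  have D_le: "D x \<le> S x y" if "0 \<le> x" "x < y" for x y
    unfolding D_def using that bdd by (intro cINF_lower) auto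
  have D_ge: "-1 \<le> D x" if "0 \<le> x" for x
    unfolding D_def using that S_ge by (intro cINF_greatest) auto
  have S_le_D: "S x y \<le> D y" if "0 \<le> x" "x < y" for x y
    unfolding D_def
  proof (rule cINF_greatest)
    fix z assume "z \<in> {y<..}"
    then have z: "y < z" by simp
    have "(P x - P y) / (x - y) \<le> (P y - P z) / (y - z)"
      using convex_on_slope_le[OF convex, of x z y] that z by simp
    then show "S x y \<le> S y z"
      unfolding S_def by (smt (verit) minus_diff_eq minus_divide_divide)
  qed auto
  have D_mono: "D x \<le> D y" if "0 \<le> x" "x \<le> y" for x y
    using D_le[of x y] S_le_D[of x y] that by (cases "x = y") auto
  \<comment> \<open>\<open>D\<close> is the right derivative of \<open>P\<close>, so \<open>1 + D\<close> is the candidate distribution function.\<close>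
  define G where "G x = (if x < 0 then 0 else 1 + D x)" for x
  have G_mono: "G x \<le> G y" if "x \<le> y" for x y
    using that D_mono[of x y] D_ge[of y] by (auto simp: G_def)
  have G_right: "continuous (at_right a) G" for a
  proof (cases "a < 0")
    case True
    have "\<forall>\<^sub>F x in at_right a. G x = 0"
      using True by (auto simp: eventually_at_right_field G_def intro!: exI[of _ 0])
    then show ?thesis
      using True by (auto simp: continuous_within G_def tendsto_eventually)
  next
    case False
    then have a: "0 \<le> a" by simp
    have right: "\<forall>\<^sub>F x in at_right a. a < x"
      by (simp add: eventually_at_right_less)
    have "(G \<longlongrightarrow> G a) (at_right a)"
    proof (rule order_tendstoI)
      fix l assume "l < G a"
      from right show "\<forall>\<^sub>F x in at_right a. l < G x"
          by eventually_elim (rule less_le_trans[OF \<open>l < G a\<close> G_mono], simp)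
    next
      fix u assume "G a < u"
      then have "D a < u - 1"
        using a by (simp add: G_def)
      \<comment> \<open>One fixed secant nearly attains the infimum at \<open>a\<close>; its slope
        depends continuously on the left endpoint and dominates \<open>D x\<close> for
        \<open>x\<close> close to \<open>a\<close>.\<close>
      then obtain y where y: "a < y" "S a y < u - 1"
        unfolding D_def using bdd[OF a] by (subst (asm) cINF_less_iff) auto
      have "(P \<longlongrightarrow> P a) (at_right a)"
      proof (rule tendsto_sandwich)
        show "\<forall>\<^sub>F x in at_right a. P a - (x - a) \<le> P x"
          using right by eventually_elim (use lip[OF a less_imp_le] in \<open>simp add: algebra_simps\<close>)
        show "\<forall>\<^sub>F x in at_right a. P x \<le> P a"
          using right by eventually_elim (use anti[OF a less_imp_le] in simp)
        have "((\<lambda>x. P a - (x - a)) \<longlongrightarrow> P a - (a - a)) (at_right a)"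
          by (intro tendsto_intros)
        then show "((\<lambda>x. P a - (x - a)) \<longlongrightarrow> P a) (at_right a)"
          by simp
      qed auto
      then have "((\<lambda>x. S x y) \<longlongrightarrow> S a y) (at_right a)"
        unfolding S_def using y by (intro tendsto_intros) auto
      then have "\<forall>\<^sub>F x in at_right a. S x y < u - 1"
        using y by (auto dest: order_tendstoD)
      moreover have "\<forall>\<^sub>F x in at_right a. x < y"
        using y by (auto simp: eventually_at_right_field)
      ultimately show "\<forall>\<^sub>F x in at_right a. G x < u"
        using right
      proof eventually_elim
        case (elim x)
        then show ?case
          using D_le[of x y] a by (simp add: G_def)
      qed
    qed
    then show ?thesis
      by (simp add: continuous_within)
  qed
  have G_bot: "(G \<longlongrightarrow> 0) at_bot"
    by (rule tendsto_eventually) (auto simp: eventually_at_bot_dense G_def intro!: exI[of _ 0])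
  \<comment> \<open>The secant from \<open>0\<close> to \<open>x\<close> bounds \<open>D x\<close>
    from below, and its slope tends to \<open>0\<close> because \<open>P\<close> converges.\<close>
  have G_top: "(G \<longlongrightarrow> 1) at_top"
  proof (rule tendsto_sandwich)
    have pos: "\<forall>\<^sub>F x in at_top. (0::real) < x"
      by (rule eventually_gt_at_top)
    show "\<forall>\<^sub>F x in at_top. 1 + (P x - P 0) / x \<le> G x"
      using pos
    proof eventually_elim
      case (elim x)
      then show ?case
        using S_le_D[of 0 x] by (simp add: G_def S_def)
    qed
    show "\<forall>\<^sub>F x in at_top. G x \<le> 1"
      using pos
    proof eventually_elim
      case (elim x)
      then show ?case
        using D_le[of x "x + 1"] S_le[of x "x + 1"] by (simp add: G_def)
    qed
    have "((\<lambda>x. (P x - P 0) / x) \<longlongrightarrow> 0) at_top"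
      by (rule tendsto_divide_0[OF tendsto_diff[OF lim tendsto_const]])
        (simp add: filterlim_at_top_imp_at_infinity filterlim_ident)
    from tendsto_add[OF tendsto_const[of 1] this]
    show "((\<lambda>x. 1 + (P x - P 0) / x) \<longlongrightarrow> 1) at_top"
      by simp
  qed auto
  define F where "F = interval_measure G"
  interpret real_distribution F
    unfolding F_def by (rule real_distribution_interval_measure[OF G_mono G_right G_bot G_top])
  have cdf: "cdf F = G"
    unfolding F_def by (rule cdf_interval_measure[OF G_mono G_right G_bot])
  \<comment> \<open>The left limit of the distribution function at \<open>0\<close> is the mass of
    the negative half-line; a jump at \<open>0\<close> itself is an admissible atom.\<close>
  have nonneg: "AE w in F. 0 \<le> w"
  proof -
    have "(cdf F \<longlongrightarrow> measure F {..<0}) (at_left 0)"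
      by (rule cdf_at_left)
    moreover have "(cdf F \<longlongrightarrow> 0) (at_left 0)"
      unfolding cdf by (rule tendsto_eventually)
        (auto simp: eventually_at_left_field G_def intro!: exI[of _ "-1"])
    ultimately have "measure F {..<0} = 0"
      using tendsto_unique trivial_limit_at_left_real by blast
    then have "AE w in F. w \<notin> {..<0}"
      by (intro AE_not_in) (auto simp: null_sets_def emeasure_eq_measure)
    then show ?thesis by eventually_elim simp
  qed
  \<comment> \<open>For nonnegative \<open>w\<close> the term \<open>min w 0\<close> vanishes, so
    the always integrable difference is \<open>min w t\<close> itself.\<close>
  have int_min: "integrable F (\<lambda>w. min w t)" if "0 \<le> t" for t
    using integrable_min_diff[of t 0]
  proof (rule Bochner_Integration.integrable_cong_AE_imp)
    show "AE w in F. min w t - min w 0 = min w t"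
      using nonneg by eventually_elim auto
  qed auto
  define K where "K t = (\<integral>w. min w t \<partial>F)" for t
  have K_diff: "K s - K t = (\<integral>w. min w s - min w t \<partial>F)" if "0 \<le> s" "0 \<le> t" for s t
    unfolding K_def using that int_min by simp
  have K0: "K 0 = 0"
  proof -
    have "K 0 = (\<integral>w. 0 \<partial>F)"
      unfolding K_def by (rule integral_cong_AE) (use nonneg in auto)
    then show ?thesis by simp
  qed
  have K_eq: "K t = P 0 - P t" if "0 \<le> t" for t
  proof -
    \<comment> \<open>Increments of \<open>P\<close> over \<open>[x, y]\<close> lie between
      \<open>(y - x) * D x\<close> and \<open>(y - x) * D y\<close>, those of \<open>K\<close>
      between the negatives of these, so the sum moves by at most
      \<open>(y - x) * (D y - D x)\<close>.\<close>
    have "K t + P t = K 0 + P 0"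
    proof (rule eq_if_increment_le[where D = D and h = "\<lambda>x. K x + P x"])
      fix x y assume xy: "0 \<le> x" "x \<le> y" "y \<le> t"
      have "P y - P x = (y - x) * S x y"
        using xy by (cases "x = y") (auto simp: S_def)
      moreover have "(y - x) * D x \<le> (y - x) * S x y" "(y - x) * S x y \<le> (y - x) * D y"
        using xy D_le[of x y] S_le_D[of x y] by (cases "x = y"; simp)+
      moreover have "(y - x) * (- D y) \<le> K y - K x" "K y - K x \<le> (y - x) * (- D x)"
        using xy integral_min_diff_bounds[of x y] K_diff[of y x] by (auto simp: cdf G_def)
      ultimately show "\<bar>(K y + P y) - (K x + P x)\<bar> \<le> (y - x) * (D y - D x)"
        by (simp add: abs_le_iff right_diff_distrib)
    qed (use that in auto)
    then show ?thesis
      using K0 by simp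
  qed
  have mono: "AE w in F. mono (\<lambda>n. min w (real n))"
    by (auto simp: mono_def min_def)
  have lim_min: "AE w in F. (\<lambda>n. min w (real n)) \<longlonglongrightarrow> w"
  proof (rule AE_I2)
    fix w :: real
    obtain N where "w < real N"
      using reals_Archimedean2 by blast
    then have "\<forall>\<^sub>F n in sequentially. min w (real n) = w"
      by (auto simp: eventually_sequentially intro!: exI[of _ N])
    then show "(\<lambda>n. min w (real n)) \<longlonglongrightarrow> w"
      by (rule tendsto_eventually)
  qed
  \<comment> \<open>The truncated means converge to \<open>P 0\<close>; monotone convergence turns
    this into integrability of the identity as well as its mean.\<close>
  have "(\<lambda>n. P (real n)) \<longlonglongrightarrow> 0"
    by (rule filterlim_compose[OF lim filterlim_real_sequentially])
  then have lim_K: "(\<lambda>n. \<integral>w. min w (real n) \<partial>F) \<longlonglongrightarrow> P 0"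
    using K_eq tendsto_diff[OF tendsto_const[of "P 0"]] by (fastforce simp: K_def)
  have int_id: "integrable F (\<lambda>w. w)"
    by (rule integrable_monotone_convergence[OF _ mono lim_min lim_K]) (auto intro!: int_min)
  have mean: "(\<integral>w. w \<partial>F) = P 0"
    by (rule integral_monotone_convergence[OF _ mono lim_min lim_K]) (auto intro!: int_min)
  have "integrable F (\<lambda>w. max 0 (w - q)) \<and> expected_excess F q = P q" if "0 \<le> q" for q
  proof -
    have "max 0 (w - q) = w - min w q" for w
      by auto
    then show ?thesis
      using int_id int_min[OF that] mean K_eq[OF that]
      by (simp add: expected_excess_def K_def)
  qed
  with nonneg show ?thesis
    using real_distribution_axioms by (auto simp: nonneg_distribution_def)
qed

section \<open>Minimizers for a regularly varying profile\<close>

text \<open>The derivative of \<open>- (l powr - \<beta>)\<close> at \<open>1\<close>. It closes the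
  gap between the bounds obtained by testing with \<open>l > 1\<close> and with
  \<open>l < 1\<close>.\<close>

lemma powr_quotient_tendsto:
  fixes \<beta> :: real
  shows "((\<lambda>l. (1 - l powr - \<beta>) / (l - 1)) \<longlongrightarrow> \<beta>) (at 1)"
proof -
  have "((\<lambda>l. - (l powr - \<beta>)) has_real_derivative \<beta>) (at 1)"
    by (auto intro!: derivative_eq_intros)
  then show ?thesis
    by (simp add: has_field_derivative_iff)
qed

text \<open>Both \<open>P (l * x) * (l * x) powr \<beta>\<close> and
  \<open>P x * x powr \<beta>\<close> tend to the nonzero \<open>C\<close>, so their quotient tends
  to \<open>1\<close> and only the factor from \<open>l\<close> survives.\<close>

lemma regularly_varying_ratio:
  fixes P :: "real \<Rightarrow> real"
  assumes lim: "((\<lambda>x. P x * x powr \<beta>) \<longlongrightarrow> C) at_top" and "C > 0" and "l > 0"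
  shows "((\<lambda>x. P (l * x) / P x) \<longlongrightarrow> l powr - \<beta>) at_top"
proof -
  have "filterlim (\<lambda>x. l * x) at_top at_top"
    using \<open>l > 0\<close> by (rule filterlim_tendsto_pos_mult_at_top[OF tendsto_const _ filterlim_ident])
  from filterlim_compose[OF lim this]
  have "((\<lambda>x. l powr - \<beta> * (P (l * x) * (l * x) powr \<beta>) / (P x * x powr \<beta>))
    \<longlongrightarrow> l powr - \<beta> * C / C) at_top"
    using \<open>C > 0\<close> by (intro tendsto_intros lim) auto
  moreover have "\<forall>\<^sub>F x in at_top. l powr - \<beta> * (P (l * x) * (l * x) powr \<beta>) / (P x * x powr \<beta>)
    = P (l * x) / P x"
    using eventually_gt_at_top[of 0]
  proof eventually_elim
    case (elim x)
    then show ?case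
      using \<open>l > 0\<close> by (simp add: powr_mult powr_minus field_simps)
  qed
  ultimately show ?thesis
    using \<open>C > 0\<close> by (simp add: tendsto_cong)
qed

lemma tendsto_0_if_powr_tail:
  fixes P :: "real \<Rightarrow> real"
  assumes lim: "((\<lambda>x. P x * x powr \<beta>) \<longlongrightarrow> C) at_top" and "\<beta> > 0"
  shows "(P \<longlongrightarrow> 0) at_top"
proof -
  have "((\<lambda>x. x powr - \<beta>) \<longlongrightarrow> 0) at_top"
    using \<open>\<beta> > 0\<close> by (intro tendsto_neg_powr filterlim_ident) auto
  from tendsto_mult[OF lim this]
  have "((\<lambda>x. P x * x powr \<beta> * x powr - \<beta>) \<longlongrightarrow> 0) at_top"
    by simp
  moreover have "\<forall>\<^sub>F x in at_top. P x * x powr \<beta> * x powr - \<beta> = P x"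
    using eventually_gt_at_top[of 0] by eventually_elim (simp add: powr_minus)
  ultimately show ?thesis
    by (simp add: tendsto_cong)
qed

text \<open>Optimality tests at multiples of the minimizer replace the first-order condition, since
  \<open>P\<close> is controlled only through its power tail. Positivity of \<open>P\<close> is
  proved alongside because the ratios divide by it.\<close>

lemma
  fixes P q :: "real \<Rightarrow> real"
  assumes anti: "\<And>x y. 0 \<le> x \<Longrightarrow> x \<le> y \<Longrightarrow> P y \<le> P x"
    and "\<beta> > 0" and "C > 0" and lim: "((\<lambda>x. P x * x powr \<beta>) \<longlongrightarrow> C) at_top"
    and q_nonneg: "\<And>\<eta>. \<eta> \<in> {0<..<1} \<Longrightarrow> q \<eta> \<ge> 0"
    and q_min: "\<And>\<eta> x. \<eta> \<in> {0<..<1} \<Longrightarrow> x \<ge> 0 \<Longrightarrow>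
      (1 - \<eta>) * q \<eta> + P (q \<eta>) \<le> (1 - \<eta>) * x + P x"
  shows minimizer_at_top: "filterlim q at_top (at_left 1)"
    and minimizer_ratio: "((\<lambda>\<eta>. (1 - \<eta>) * q \<eta> / P (q \<eta>)) \<longlongrightarrow> \<beta>) (at_left 1)"
    and minimizer_profile_pos: "\<And>x. x \<ge> 0 \<Longrightarrow> P x > 0"
proof -
  have unit: "\<forall>\<^sub>F \<eta> in at_left 1. \<eta> \<in> {0<..<1::real}"
    by (auto simp: eventually_at_left_field intro!: exI[of _ 0])
  show pos: "P x > 0" if "x \<ge> 0" for x
  proof -
    have "\<forall>\<^sub>F y in at_top. P y * y powr \<beta> > 0"
      using lim \<open>C > 0\<close> by (rule order_tendstoD)
    moreover have "\<forall>\<^sub>F y in at_top. x \<le> y"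
      by (rule eventually_ge_at_top)
    ultimately have "\<forall>\<^sub>F y in at_top. 0 < P y * y powr \<beta> \<and> x \<le> y"
      by eventually_elim simp
    then obtain y where "0 < P y * y powr \<beta>" "x \<le> y"
      using eventually_happens trivial_limit_at_top_linorder by blast
    then have "P y > 0"
      by (smt (verit) mult_nonpos_nonneg powr_ge_zero)
    then show ?thesis
      using anti[OF that \<open>x \<le> y\<close>] by simp
  qed
  have P_0: "(P \<longlongrightarrow> 0) at_top"
    using lim \<open>\<beta> > 0\<close> by (rule tendsto_0_if_powr_tail)
  show q_top: "filterlim q at_top (at_left 1)"
    unfolding filterlim_at_top
  proof
    fix Z :: real
    \<comment> \<open>Monotonicity of \<open>P\<close> is available for nonnegative arguments, so a
      negative \<open>Z\<close> is replaced by \<open>0\<close>.\<close>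
    define M where "M = max Z 0"
    have "P M > 0"
      by (rule pos) (simp add: M_def)
    then have "\<forall>\<^sub>F x in at_top. P x < P M / 2"
      using P_0 by (intro order_tendstoD) auto
    then have "\<forall>\<^sub>F x in at_top. P x < P M / 2 \<and> 0 \<le> x"
      using eventually_ge_at_top[of 0] by eventually_elim simp
    \<comment> \<open>The competitor: a minimizer below \<open>Z\<close> costs at least
      \<open>P M\<close>, while \<open>X\<close> costs less than \<open>P M\<close> once
      \<open>\<eta>\<close> is close to \<open>1\<close>.\<close>
    then obtain X where X: "P X < P M / 2" "0 \<le> X"
      using eventually_happens trivial_limit_at_top_linorder by blast
    have "((\<lambda>\<eta>. (1 - \<eta>) * X) \<longlongrightarrow> (1 - 1) * X) (at_left 1)"
      by (intro tendsto_intros)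
    then have "\<forall>\<^sub>F \<eta> in at_left 1. (1 - \<eta>) * X < P M / 2"
      using \<open>P M > 0\<close> by (intro order_tendstoD) auto
    then show "\<forall>\<^sub>F \<eta> in at_left 1. Z \<le> q \<eta>"
      using unit
    proof eventually_elim
      case (elim \<eta>)
      show ?case
      proof (rule ccontr)
        assume "\<not> Z \<le> q \<eta>"
        then have "P M \<le> P (q \<eta>)"
          using q_nonneg[OF elim(2)] by (intro anti) (auto simp: M_def)
        moreover have "0 \<le> (1 - \<eta>) * q \<eta>"
          using q_nonneg[OF elim(2)] elim(2) by simp
        ultimately show False
          using q_min[OF elim(2) X(2)] elim(1) X(1) by linarith
      qed
    qed
  qed
  have ratio: "((\<lambda>\<eta>. P (l * q \<eta>) / P (q \<eta>)) \<longlongrightarrow> l powr - \<beta>) (at_left 1)" if "l > 0" for l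
    by (rule filterlim_compose[OF regularly_varying_ratio[OF lim \<open>C > 0\<close> that] q_top])
  \<comment> \<open>Comparing the minimizer \<open>q \<eta>\<close> with \<open>l * q \<eta>\<close> bounds the ratio by \<open>L l\<close> in the limit, from below
    for \<open>l > 1\<close> and from above for \<open>l < 1\<close>.\<close>
  define L where "L l = (1 - l powr - \<beta>) / (l - 1)" for l
  have L_right: "(L \<longlongrightarrow> \<beta>) (at_right 1)" and L_left: "(L \<longlongrightarrow> \<beta>) (at_left 1)"
    using powr_quotient_tendsto[of \<beta>] unfolding L_def filterlim_at_split by auto
  have ratio_L: "((\<lambda>\<eta>. (1 - P (l * q \<eta>) / P (q \<eta>)) / (l - 1)) \<longlongrightarrow> L l) (at_left 1)"
    if "l > 0" "l \<noteq> 1" for l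
    unfolding L_def using that by (intro tendsto_intros ratio) auto
  \<comment> \<open>Not yet divided by \<open>l - 1\<close>, whose sign decides the direction of the
    bound on the ratio.\<close>
  have key: "(1 - P (l * q \<eta>) / P (q \<eta>)) \<le> (1 - \<eta>) * q \<eta> / P (q \<eta>) * (l - 1)"
    if "\<eta> \<in> {0<..<1}" "l > 0" for l \<eta>
  proof -
    have "P (q \<eta>) - P (l * q \<eta>) \<le> (1 - \<eta>) * q \<eta> * (l - 1)"
      using q_min[OF that(1), of "l * q \<eta>"] q_nonneg[OF that(1)] that(2)
      by (simp add: algebra_simps)
    then have "(P (q \<eta>) - P (l * q \<eta>)) / P (q \<eta>) \<le> (1 - \<eta>) * q \<eta> * (l - 1) / P (q \<eta>)"
      using pos[OF q_nonneg[OF that(1)]] by (intro divide_right_mono) auto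
    then show ?thesis
      using pos[OF q_nonneg[OF that(1)]] by (simp add: diff_divide_distrib)
  qed
  show "((\<lambda>\<eta>. (1 - \<eta>) * q \<eta> / P (q \<eta>)) \<longlongrightarrow> \<beta>) (at_left 1)"
  proof (rule order_tendstoI)
    fix a assume "a < \<beta>"
    then have "\<forall>\<^sub>F l in at_right 1. a < L l"
      using L_right by (intro order_tendstoD)
    then have "\<forall>\<^sub>F l in at_right 1. a < L l \<and> 1 < l"
      using eventually_at_right_less[of 1] by eventually_elim simp
    \<comment> \<open>The multiplier is fixed first, with \<open>L l\<close> already beyond
      \<open>a\<close>; only then does \<open>\<eta>\<close> tend to \<open>1\<close>.\<close>
    then obtain l where l: "a < L l" "1 < l"
      using eventually_happens trivial_limit_at_right_real by blast
    then have "\<forall>\<^sub>F \<eta> in at_left 1. a < (1 - P (l * q \<eta>) / P (q \<eta>)) / (l - 1)"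
      by (intro order_tendstoD[OF ratio_L]) auto
    then show "\<forall>\<^sub>F \<eta> in at_left 1. a < (1 - \<eta>) * q \<eta> / P (q \<eta>)"
      using unit
    proof eventually_elim
      case (elim \<eta>)
      have "(1 - P (l * q \<eta>) / P (q \<eta>)) / (l - 1) \<le> (1 - \<eta>) * q \<eta> / P (q \<eta>)"
        using key[OF elim(2), of l] l by (subst pos_divide_le_eq) auto
      then show ?case
        using elim by linarith
    qed
  next
    fix u assume "\<beta> < u"
    then have "\<forall>\<^sub>F l in at_left 1. L l < u"
      using L_left by (intro order_tendstoD)
    then have "\<forall>\<^sub>F l in at_left 1. L l < u \<and> 0 < l \<and> l < 1"
      using unit by eventually_elim simp
    then obtain l where l: "L l < u" "0 < l" "l < 1"
      using eventually_happens trivial_limit_at_left_real by blast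
    then have "\<forall>\<^sub>F \<eta> in at_left 1. (1 - P (l * q \<eta>) / P (q \<eta>)) / (l - 1) < u"
      by (intro order_tendstoD[OF ratio_L]) auto
    then show "\<forall>\<^sub>F \<eta> in at_left 1. (1 - \<eta>) * q \<eta> / P (q \<eta>) < u"
      using unit
    proof eventually_elim
      case (elim \<eta>)
      have "(1 - \<eta>) * q \<eta> / P (q \<eta>) \<le> (1 - P (l * q \<eta>) / P (q \<eta>)) / (l - 1)"
        using key[OF elim(2), of l] l by (subst neg_le_divide_eq) auto
      then show ?case
        using elim by linarith
    qed
  qed
qed

section \<open>The tail of the worst-case excess\<close>

text \<open>Convexity is used on the open half-line. At \<open>w = 0\<close> the tangent has the
  value \<open>(1 - \<alpha>) * b powr \<alpha>\<close>, which is at most \<open>0\<close>.\<close>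

lemma powr_above_tangent:
  fixes b w \<alpha> :: real
  assumes "\<alpha> > 1" "b > 0" "w \<ge> 0"
  shows "b powr \<alpha> + \<alpha> * b powr (\<alpha> - 1) * (w - b) \<le> w powr \<alpha>"
proof (cases "w = 0")
  case True
  have "b powr \<alpha> = b powr (\<alpha> - 1) * b"
    using \<open>b > 0\<close> by (simp add: powr_mult_base mult.commute)
  then have "b powr \<alpha> + \<alpha> * b powr (\<alpha> - 1) * (w - b) = (1 - \<alpha>) * b powr \<alpha>"
    using True by (simp add: algebra_simps)
  also have "\<dots> \<le> 0"
    using \<open>\<alpha> > 1\<close> by (intro mult_nonpos_nonneg) auto
  finally show ?thesis
    using True by simp
next
  case False
  have "\<alpha> * b powr (\<alpha> - 1) * (w - b) \<le> w powr \<alpha> - b powr \<alpha>"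
    using assms False
    by (intro convex_on_imp_above_tangent[where A = "{0<..}"] powr_convex)
      (auto intro!: derivative_eq_intros simp: interior_open)
  then show ?thesis by simp
qed

text \<open>The tangent to \<open>w powr \<alpha>\<close> that vanishes at \<open>w = q\<close> touches at \<open>b\<close>.\<close>

lemma excess_le_powr:
  fixes b w q \<alpha> :: real
  assumes "\<alpha> > 1" "q > 0" "w \<ge> 0" and b: "b = \<alpha> / (\<alpha> - 1) * q"
  shows "w - q \<le> w powr \<alpha> / (\<alpha> * b powr (\<alpha> - 1))"
proof -
  have "b > 0"
    using assms by simp
  have "b powr \<alpha> = b powr (\<alpha> - 1) * b"
    using \<open>b > 0\<close> by (simp add: powr_mult_base mult.commute)
  moreover have "\<alpha> * q = (\<alpha> - 1) * b"
    using assms by (simp add: b)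
  ultimately have "b powr \<alpha> + \<alpha> * b powr (\<alpha> - 1) * (w - b) = (w - q) * (\<alpha> * b powr (\<alpha> - 1))"
    by algebra
  with powr_above_tangent[OF \<open>\<alpha> > 1\<close> \<open>b > 0\<close> \<open>w \<ge> 0\<close>] show ?thesis
    using \<open>\<alpha> > 1\<close> \<open>b > 0\<close> by (subst pos_le_divide_eq) auto
qed

section \<open>Two-point laws with prescribed moments\<close>

definition two_point :: "real \<Rightarrow> real \<Rightarrow> real \<Rightarrow> real measure" where
  "two_point p a b = distr (measure_pmf (bernoulli_pmf p)) borel (\<lambda>x. if x then b else a)"

lemma integrable_two_point:
  fixes f :: "real \<Rightarrow> real"
  assumes "f \<in> borel_measurable borel"
  shows "integrable (two_point p a b) f"
  using assms unfolding two_point_def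
  by (subst integrable_distr_eq) (auto intro!: integrable_measure_pmf_finite)

lemma integral_two_point:
  fixes f :: "real \<Rightarrow> real"
  assumes "f \<in> borel_measurable borel" "0 \<le> p" "p \<le> 1"
  shows "(\<integral>w. f w \<partial>two_point p a b) = p * f b + (1 - p) * f a"
  using assms unfolding two_point_def by (subst integral_distr) auto

lemma nonneg_distribution_two_point:
  assumes "0 \<le> a" "0 \<le> b"
  shows "nonneg_distribution (two_point p a b)"
  using assms unfolding nonneg_distribution_def two_point_def
  by (auto intro!: prob_space.real_distribution_distr simp: AE_distr_iff prob_space_measure_pmf)

text \<open>The mean constraint forces the lower atom to be \<open>A p\<close>. The
  \<open>\<alpha>\<close>-moment then varies continuously from \<open>m1 powr \<alpha>\<close> at
  \<open>p = 0\<close> to \<open>m1 * b powr (\<alpha> - 1)\<close> at \<open>p = m1 / b\<close>,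
  where the lower atom reaches \<open>0\<close>, so the intermediate value theorem applies.\<close>

lemma exists_two_point_moments:
  fixes \<alpha> m1 m\<alpha> b :: real
  assumes "\<alpha> > 1" "m1 > 0" "m\<alpha> > m1 powr \<alpha>" "b > m1" "m\<alpha> \<le> m1 * b powr (\<alpha> - 1)"
  obtains p a where "0 \<le> p" "p < 1" "0 \<le> a" "a \<le> m1"
    "p * b + (1 - p) * a = m1" "p * b powr \<alpha> + (1 - p) * a powr \<alpha> = m\<alpha>"
proof -
  define A where "A p = (m1 - p * b) / (1 - p)" for p
  define f where "f p = p * b powr \<alpha> + (1 - p) * A p powr \<alpha>" for p
  have lt1: "p < 1" if "p \<le> m1 / b" for p
    using that assms by (smt (verit) divide_less_eq_1_pos)
  have A_nonneg: "0 \<le> A p" if "0 \<le> p" "p \<le> m1 / b" for p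
    using that lt1[OF that(2)] assms by (auto simp: A_def pos_le_divide_eq)
  have "continuous_on {0..m1 / b} A"
    unfolding A_def using lt1 by (intro continuous_intros) fastforce
  then have "continuous_on {0..m1 / b} (\<lambda>p. A p powr \<alpha>)"
    using A_nonneg \<open>\<alpha> > 1\<close> by (intro continuous_on_powr' continuous_on_const) auto
  then have "continuous_on {0..m1 / b} f"
    unfolding f_def
    by (intro continuous_on_add continuous_on_mult continuous_on_diff continuous_on_id continuous_on_const)
  moreover have "f 0 \<le> m\<alpha>"
    using assms by (simp add: f_def A_def)
  moreover have "m\<alpha> \<le> f (m1 / b)"
  proof -
    have "b powr \<alpha> = b * b powr (\<alpha> - 1)"
      using assms by (simp add: powr_mult_base)
    then have "f (m1 / b) = m1 * b powr (\<alpha> - 1)"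
      using assms by (simp add: f_def A_def)
    then show ?thesis
      using assms by simp
  qed
  moreover have "0 \<le> m1 / b"
    using assms by simp
  ultimately obtain p where p: "0 \<le> p" "p \<le> m1 / b" "f p = m\<alpha>"
    using IVT'[of f 0 m\<alpha> "m1 / b"] by blast
  show ?thesis
  proof
    show "0 \<le> p" "p < 1" "0 \<le> A p"
      using p lt1 A_nonneg by auto
    have "p * m1 \<le> p * b"
      using p assms by (intro mult_left_mono) auto
    then show "A p \<le> m1"
      using lt1[OF p(2)] by (auto simp: A_def pos_divide_le_eq algebra_simps)
    show "p * b + (1 - p) * A p = m1"
      using lt1[OF p(2)] by (simp add: A_def)
    show "p * b powr \<alpha> + (1 - p) * A p powr \<alpha> = m\<alpha>"
      using p by (simp add: f_def)
  qed
qed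

text \<open>As \<open>a \<le> m1\<close>, the lower atom contributes at most
  \<open>m1 powr \<alpha>\<close> to the moment, so the upper atom has weight at least
  \<open>(m\<alpha> - m1 powr \<alpha>) / b powr \<alpha>\<close>; the excess is at least its weight
  times \<open>b - q\<close>.\<close>

lemma ambiguity_set_excess_lower_bound:
  fixes \<alpha> m1 m\<alpha> b :: real
  assumes "\<alpha> > 1" "m1 > 0" "m\<alpha> > m1 powr \<alpha>" "b > m1" "m\<alpha> \<le> m1 * b powr (\<alpha> - 1)"
  obtains F where "F \<in> ambiguity_set \<alpha> m1 m\<alpha>"
    "\<And>q. q \<le> b \<Longrightarrow> (m\<alpha> - m1 powr \<alpha>) * ((b - q) / b powr \<alpha>) \<le> expected_excess F q"
proof -
  obtain p a where p: "0 \<le> p" "p < 1" "0 \<le> a" "a \<le> m1"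
    "p * b + (1 - p) * a = m1" "p * b powr \<alpha> + (1 - p) * a powr \<alpha> = m\<alpha>"
    using exists_two_point_moments[OF assms] by blast
  have "b > 0"
    using assms by simp
  show ?thesis
  proof
    show "two_point p a b \<in> ambiguity_set \<alpha> m1 m\<alpha>"
      using p \<open>b > 0\<close> unfolding ambiguity_set_def
      by (simp add: nonneg_distribution_two_point integrable_two_point integral_two_point)
    fix q assume "q \<le> b"
    have "(1 - p) * a powr \<alpha> \<le> 1 * m1 powr \<alpha>"
      using p assms by (intro mult_mono powr_mono2) auto
    then have "m\<alpha> - m1 powr \<alpha> \<le> p * b powr \<alpha>"
      using p by simp
    then have "(m\<alpha> - m1 powr \<alpha>) * ((b - q) / b powr \<alpha>) \<le> p * b powr \<alpha> * ((b - q) / b powr \<alpha>)"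
      using \<open>q \<le> b\<close> by (intro mult_right_mono) auto
    also have "\<dots> = p * (b - q)"
      using \<open>b > 0\<close> by simp
    also have "\<dots> \<le> p * max 0 (b - q) + (1 - p) * max 0 (a - q)"
      using p by (intro add_increasing2 mult_left_mono) auto
    also have "\<dots> = expected_excess (two_point p a b) q"
      using p unfolding expected_excess_def by (subst integral_two_point) auto
    finally show "(m\<alpha> - m1 powr \<alpha>) * ((b - q) / b powr \<alpha>) \<le> expected_excess (two_point p a b) q" .
  qed
qed

lemma eventually_large_enough:
  fixes \<alpha> m1 m\<alpha> :: real
  assumes "\<alpha> > 1" "m1 > 0"
  shows "\<forall>\<^sub>F b in at_top. b > m1 \<and> m\<alpha> \<le> m1 * b powr (\<alpha> - 1)"
proof -
  have "filterlim (\<lambda>b. m1 * b powr (\<alpha> - 1)) at_top at_top"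
    using assms
    by (intro filterlim_tendsto_pos_mult_at_top[OF tendsto_const] real_powr_at_top) auto
  then show ?thesis
    by (intro eventually_conj eventually_gt_at_top) (simp add: filterlim_at_top)
qed

lemma ambiguity_set_nonempty:
  assumes "\<alpha> > 1" "m1 > 0" "m\<alpha> > m1 powr \<alpha>"
  shows "ambiguity_set \<alpha> m1 m\<alpha> \<noteq> {}"
proof -
  obtain b where "b > m1" "m\<alpha> \<le> m1 * b powr (\<alpha> - 1)"
    using eventually_happens[OF eventually_large_enough[OF assms(1,2)]] by auto
  from ambiguity_set_excess_lower_bound[OF assms this] show ?thesis
    by blast
qed

section \<open>The excess of a single law\<close>

lemma integrable_excess:
  fixes F :: "real measure"
  assumes "nonneg_distribution F" "integrable F (\<lambda>w. w)"
  shows "integrable F (\<lambda>w. max 0 (w - q))"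
proof -
  interpret real_distribution F
    using assms by (simp add: nonneg_distribution_def)
  show ?thesis
    using assms by (intro integrable_max Bochner_Integration.integrable_diff) auto
qed

text \<open>Pointwise properties of \<open>max 0 (w - q)\<close>, integrated; each inequality has a
  form that survives taking suprema over laws.\<close>

lemma
  fixes F :: "real measure"
  assumes F: "nonneg_distribution F" "integrable F (\<lambda>w. w)"
  shows expected_excess_0: "expected_excess F 0 = (\<integral>w. w \<partial>F)"
    and expected_excess_antimono: "x \<le> y \<Longrightarrow> expected_excess F y \<le> expected_excess F x"
    and expected_excess_lipschitz: "x \<le> y \<Longrightarrow> expected_excess F x \<le> expected_excess F y + (y - x)"
    and expected_excess_convex: "0 \<le> t \<Longrightarrow> t \<le> 1 \<Longrightarrow>
      expected_excess F ((1 - t) * x + t * y) \<le> (1 - t) * expected_excess F x + t * expected_excess F y"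
proof -
  interpret real_distribution F
    using F by (simp add: nonneg_distribution_def)
  note int = integrable_excess[OF F]
  have "AE w in F. 0 \<le> w"
    using F by (simp add: nonneg_distribution_def)
  then show "expected_excess F 0 = (\<integral>w. w \<partial>F)"
    unfolding expected_excess_def by (intro integral_cong_AE) auto
  show "expected_excess F y \<le> expected_excess F x" if "x \<le> y"
    unfolding expected_excess_def using that by (intro integral_mono int) auto
  show "expected_excess F x \<le> expected_excess F y + (y - x)" if "x \<le> y"
  proof -
    have "expected_excess F x \<le> (\<integral>w. max 0 (w - y) + (y - x) \<partial>F)"
      unfolding expected_excess_def using that
      by (intro integral_mono Bochner_Integration.integrable_add int) auto
    also have "\<dots> = expected_excess F y + (y - x)"
      unfolding expected_excess_def using int[of y] prob_space by simp
    finally show ?thesis .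
  qed
  show "expected_excess F ((1 - t) * x + t * y) \<le> (1 - t) * expected_excess F x + t * expected_excess F y"
    if t: "0 \<le> t" "t \<le> 1"
  proof -
    have "expected_excess F ((1 - t) * x + t * y)
      \<le> (\<integral>w. (1 - t) * max 0 (w - x) + t * max 0 (w - y) \<partial>F)"
      unfolding expected_excess_def
    proof (intro integral_mono Bochner_Integration.integrable_add integrable_mult_right int)
      fix w
      have "(1 - t) * (w - x) + t * (w - y) \<le> (1 - t) * max 0 (w - x) + t * max 0 (w - y)"
        using t by (intro add_mono mult_left_mono) auto
      moreover have "w - ((1 - t) * x + t * y) = (1 - t) * (w - x) + t * (w - y)"
        by (simp add: algebra_simps)
      moreover have "0 \<le> (1 - t) * max 0 (w - x) + t * max 0 (w - y)"
        using t by simp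
      ultimately show "max 0 (w - ((1 - t) * x + t * y)) \<le> (1 - t) * max 0 (w - x) + t * max 0 (w - y)"
        by simp
    qed
    also have "\<dots> = (1 - t) * expected_excess F x + t * expected_excess F y"
      unfolding expected_excess_def using int by simp
    finally show ?thesis .
  qed
qed

lemma ambiguity_setD:
  assumes "F \<in> ambiguity_set \<alpha> m1 m\<alpha>"
  shows "nonneg_distribution F" "integrable F (\<lambda>w. w)" "(\<integral>w. w \<partial>F) = m1"
    "integrable F (\<lambda>w. w powr \<alpha>)" "(\<integral>w. w powr \<alpha> \<partial>F) = m\<alpha>"
  using assms by (auto simp: ambiguity_set_def)

text \<open>The supremum of reals needs an upper bound: for \<open>q \<ge> 0\<close> the excess is
  at most its value at \<open>0\<close>, the mean \<open>m1\<close>.\<close>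

lemma expected_excess_le_worst_case:
  assumes F: "F \<in> ambiguity_set \<alpha> m1 m\<alpha>" and "q \<ge> 0"
  shows "expected_excess F q \<le> worst_case_excess \<alpha> m1 m\<alpha> q"
  unfolding worst_case_excess_def
proof (rule cSUP_upper[OF F])
  show "bdd_above ((\<lambda>F. expected_excess F q) ` ambiguity_set \<alpha> m1 m\<alpha>)"
  proof (rule bdd_aboveI2)
    fix G assume "G \<in> ambiguity_set \<alpha> m1 m\<alpha>"
    from ambiguity_setD[OF this] show "expected_excess G q \<le> m1"
      using expected_excess_0[of G] expected_excess_antimono[of G 0 q] \<open>q \<ge> 0\<close> by simp
  qed
qed

section \<open>Shape and tail of the worst-case excess\<close>

context
  fixes \<alpha> m1 m\<alpha> :: real
  assumes \<alpha>: "\<alpha> > 1" and m1: "m1 > 0" and m\<alpha>: "m\<alpha> > m1 powr \<alpha>"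
begin

text \<open>The supremum of reals also needs a nonempty set, which the two-point laws
  provide.\<close>

lemma worst_case_excess_least:
  assumes "\<And>F. F \<in> ambiguity_set \<alpha> m1 m\<alpha> \<Longrightarrow> expected_excess F q \<le> c"
  shows "worst_case_excess \<alpha> m1 m\<alpha> q \<le> c"
  unfolding worst_case_excess_def
  using assms ambiguity_set_nonempty[OF \<alpha> m1 m\<alpha>] by (intro cSUP_least)

lemma worst_case_excess_antimono:
  assumes "0 \<le> x" "x \<le> y"
  shows "worst_case_excess \<alpha> m1 m\<alpha> y \<le> worst_case_excess \<alpha> m1 m\<alpha> x"
proof (rule worst_case_excess_least)
  fix F assume F: "F \<in> ambiguity_set \<alpha> m1 m\<alpha>"
  show "expected_excess F y \<le> worst_case_excess \<alpha> m1 m\<alpha> x"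
    using expected_excess_antimono[OF ambiguity_setD(1,2)[OF F], of x y]
      expected_excess_le_worst_case[OF F, of x] assms by simp
qed

lemma worst_case_excess_lipschitz:
  assumes "0 \<le> x" "x \<le> y"
  shows "worst_case_excess \<alpha> m1 m\<alpha> x - worst_case_excess \<alpha> m1 m\<alpha> y \<le> y - x"
proof -
  have "worst_case_excess \<alpha> m1 m\<alpha> x \<le> worst_case_excess \<alpha> m1 m\<alpha> y + (y - x)"
  proof (rule worst_case_excess_least)
    fix F assume F: "F \<in> ambiguity_set \<alpha> m1 m\<alpha>"
    show "expected_excess F x \<le> worst_case_excess \<alpha> m1 m\<alpha> y + (y - x)"
      using expected_excess_lipschitz[OF ambiguity_setD(1,2)[OF F], of x y]
        expected_excess_le_worst_case[OF F, of y] assms by simp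
  qed
  then show ?thesis by simp
qed

lemma worst_case_excess_convex: "convex_on {0..} (worst_case_excess \<alpha> m1 m\<alpha>)"
proof (rule convex_onI)
  fix t x y :: real
  assume t: "t > 0" "t < 1" and xy: "x \<in> {0..}" "y \<in> {0..}"
  show "worst_case_excess \<alpha> m1 m\<alpha> ((1 - t) *\<^sub>R x + t *\<^sub>R y)
    \<le> (1 - t) * worst_case_excess \<alpha> m1 m\<alpha> x + t * worst_case_excess \<alpha> m1 m\<alpha> y"
  proof (rule worst_case_excess_least)
    fix F assume F: "F \<in> ambiguity_set \<alpha> m1 m\<alpha>"
    have "expected_excess F ((1 - t) *\<^sub>R x + t *\<^sub>R y)
      \<le> (1 - t) * expected_excess F x + t * expected_excess F y"
      using expected_excess_convex[OF ambiguity_setD(1,2)[OF F], of t x y] t by simp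
    also have "\<dots> \<le> (1 - t) * worst_case_excess \<alpha> m1 m\<alpha> x + t * worst_case_excess \<alpha> m1 m\<alpha> y"
      using t xy by (intro add_mono mult_left_mono expected_excess_le_worst_case F) auto
    finally show "expected_excess F ((1 - t) *\<^sub>R x + t *\<^sub>R y)
      \<le> (1 - t) * worst_case_excess \<alpha> m1 m\<alpha> x + t * worst_case_excess \<alpha> m1 m\<alpha> y" .
  qed
qed simp

text \<open>For \<open>q > 0\<close>, this is \<open>q powr (\<alpha> - 1)\<close> times the maximum
  over \<open>b > q\<close> of
  \<open>(m\<alpha> - m1 powr \<alpha>) * (b - q) / b powr \<alpha>\<close>, attained at
  \<open>b = \<alpha> / (\<alpha> - 1) * q\<close>.\<close>

definition "tail_const = (m\<alpha> - m1 powr \<alpha>) / (\<alpha> * (\<alpha> / (\<alpha> - 1)) powr (\<alpha> - 1))"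

text \<open>The two-point law with the optimal upper atom \<open>k * q\<close> gives exactly this
  constant; \<open>q\<close> must be large for that atom to be compatible with both moments.\<close>

lemma worst_case_excess_lower:
  "\<forall>\<^sub>F q in at_top. tail_const \<le> worst_case_excess \<alpha> m1 m\<alpha> q * q powr (\<alpha> - 1)"
proof -
  define k where "k = \<alpha> / (\<alpha> - 1)"
  have "k > 1"
    using \<alpha> by (simp add: k_def)
  have "filterlim (\<lambda>q. k * q) at_top at_top"
    using \<open>k > 1\<close> by (intro filterlim_tendsto_pos_mult_at_top[OF tendsto_const] filterlim_ident) auto
  then have "\<forall>\<^sub>F q in at_top. k * q > m1 \<and> m\<alpha> \<le> m1 * (k * q) powr (\<alpha> - 1)"
    using eventually_large_enough[OF \<alpha> m1] by (rule eventually_compose_filterlim[rotated])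
  then show ?thesis
    using eventually_gt_at_top[of 0]
  proof eventually_elim
    case (elim q)
    then have b: "k * q > m1" "m\<alpha> \<le> m1 * (k * q) powr (\<alpha> - 1)" and "q > 0"
      by auto
    obtain F where F: "F \<in> ambiguity_set \<alpha> m1 m\<alpha>"
      "\<And>x. x \<le> k * q \<Longrightarrow> (m\<alpha> - m1 powr \<alpha>) * ((k * q - x) / (k * q) powr \<alpha>) \<le> expected_excess F x"
      using ambiguity_set_excess_lower_bound[OF \<alpha> m1 m\<alpha> b] by blast
    have "k * q - q = k * q / \<alpha>"
      using \<alpha> by (simp add: k_def field_simps)
    moreover have "(k * q) powr \<alpha> = (k * q) * (k powr (\<alpha> - 1) * q powr (\<alpha> - 1))"
      using \<open>k > 1\<close> \<open>q > 0\<close> powr_mult_base[of "k * q" "\<alpha> - 1"] by (simp add: powr_mult)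
    ultimately have "tail_const = (m\<alpha> - m1 powr \<alpha>) * ((k * q - q) / (k * q) powr \<alpha>) * q powr (\<alpha> - 1)"
      using \<open>k > 1\<close> \<open>q > 0\<close> unfolding tail_const_def k_def[symmetric] by simp
    also have "\<dots> \<le> worst_case_excess \<alpha> m1 m\<alpha> q * q powr (\<alpha> - 1)"
    proof (rule mult_right_mono)
      have "(m\<alpha> - m1 powr \<alpha>) * ((k * q - q) / (k * q) powr \<alpha>) \<le> expected_excess F q"
        using \<open>k > 1\<close> \<open>q > 0\<close> by (intro F) auto
      also have "\<dots> \<le> worst_case_excess \<alpha> m1 m\<alpha> q"
        using \<open>q > 0\<close> by (intro expected_excess_le_worst_case F) auto
      finally show "(m\<alpha> - m1 powr \<alpha>) * ((k * q - q) / (k * q) powr \<alpha>) \<le> worst_case_excess \<alpha> m1 m\<alpha> q" .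
    qed simp
    finally show ?case .
  qed
qed

text \<open>For large \<open>w\<close> the tangent part of \<open>\<phi>\<close> is at most
  \<open>d * w powr \<alpha>\<close>, which costs the factor \<open>1 / (1 - d)\<close>. Beyond the
  threshold \<open>Q\<close>, \<open>excess_le_powr\<close> handles \<open>w > q\<close>, and
  \<open>\<phi> w \<ge> 0\<close> handles \<open>w \<le> q\<close>.\<close>

lemma worst_case_excess_upper:
  assumes d: "0 < d" "d < 1"
  shows "\<forall>\<^sub>F q in at_top. worst_case_excess \<alpha> m1 m\<alpha> q * q powr (\<alpha> - 1) \<le> tail_const / (1 - d)"
proof -
  define k where "k = \<alpha> / (\<alpha> - 1)"
  have "k > 1"
    using \<alpha> by (simp add: k_def)
  \<comment> \<open>All laws in the ambiguity set give \<open>\<phi>\<close> the same mean \<open>m\<alpha> - m1 powr \<alpha>\<close>; using \<open>\<phi>\<close> instead of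
    \<open>w powr \<alpha>\<close> discounts the bulk of the mass, which sits near \<open>m1\<close>.\<close>
  define \<phi> where "\<phi> w = w powr \<alpha> - (m1 powr \<alpha> + \<alpha> * m1 powr (\<alpha> - 1) * (w - m1))" for w
  have \<phi>_nonneg: "0 \<le> \<phi> w" if "0 \<le> w" for w
    using powr_above_tangent[OF \<alpha> m1 that] by (simp add: \<phi>_def)
  have "filterlim (\<lambda>w. w powr (\<alpha> - 1)) at_top at_top"
    using \<alpha> by (intro real_powr_at_top) auto
  \<comment> \<open>Chosen so that the linear term of the tangent is at most
    \<open>d * w powr \<alpha>\<close>; its constant term
    \<open>(1 - \<alpha>) * m1 powr \<alpha>\<close> is negative and only helps.\<close>
  then have "\<forall>\<^sub>F w in at_top. \<alpha> * m1 powr (\<alpha> - 1) / d \<le> w powr (\<alpha> - 1)"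
    by (simp add: filterlim_at_top)
  then have "\<forall>\<^sub>F w in at_top. (1 - d) * w powr \<alpha> \<le> \<phi> w"
    using eventually_gt_at_top[of 0]
  proof eventually_elim
    case (elim w)
    have "m1 powr \<alpha> = m1 powr (\<alpha> - 1) * m1"
      using m1 by (simp add: powr_mult_base mult.commute)
    moreover have "m1 powr (\<alpha> - 1) * m1 \<le> \<alpha> * (m1 powr (\<alpha> - 1) * m1)"
      using \<alpha> m1 by simp
    moreover have "\<alpha> * m1 powr (\<alpha> - 1) * w \<le> d * w powr (\<alpha> - 1) * w"
      using elim d by (intro mult_right_mono) (auto simp: pos_divide_le_eq mult.commute)
    moreover have "w powr \<alpha> = w powr (\<alpha> - 1) * w"
      using elim by (simp add: powr_mult_base mult.commute)
    ultimately show ?case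
      by (simp add: \<phi>_def algebra_simps)
  qed
  then obtain Q where Q: "\<And>w. w \<ge> Q \<Longrightarrow> (1 - d) * w powr \<alpha> \<le> \<phi> w"
    by (auto simp: eventually_at_top_linorder)
  have "\<forall>\<^sub>F q in at_top. Q \<le> q"
    by (rule eventually_ge_at_top)
  then show ?thesis
    using eventually_gt_at_top[of 0]
  proof eventually_elim
    case (elim q)
    \<comment> \<open>The denominator in \<open>excess_le_powr\<close> for the touching point
      \<open>k * q\<close>.\<close>
    define c where "c = \<alpha> * (k * q) powr (\<alpha> - 1)"
    have "c > 0"
      using \<alpha> \<open>k > 1\<close> elim by (simp add: c_def)
    have "worst_case_excess \<alpha> m1 m\<alpha> q \<le> (m\<alpha> - m1 powr \<alpha>) / ((1 - d) * c)"
    proof (rule worst_case_excess_least)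
      fix F assume "F \<in> ambiguity_set \<alpha> m1 m\<alpha>"
      note F = ambiguity_setD[OF this]
      interpret real_distribution F
        using F by (simp add: nonneg_distribution_def)
      have int_\<phi>: "integrable F \<phi>"
        unfolding \<phi>_def using F by auto
      have val_\<phi>: "(\<integral>w. \<phi> w \<partial>F) = m\<alpha> - m1 powr \<alpha>"
        unfolding \<phi>_def using F prob_space by simp
      have nonneg: "AE w in F. 0 \<le> w"
        using F by (simp add: nonneg_distribution_def)
      have "expected_excess F q \<le> (\<integral>w. \<phi> w / ((1 - d) * c) \<partial>F)"
        unfolding expected_excess_def
      proof (rule integral_mono_AE)
        show "AE w in F. max 0 (w - q) \<le> \<phi> w / ((1 - d) * c)"
          using nonneg
        proof eventually_elim
          fix w :: real assume w: "0 \<le> w"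
          show "max 0 (w - q) \<le> \<phi> w / ((1 - d) * c)"
          proof (cases "w \<le> q")
            case True
            then show ?thesis
              using \<phi>_nonneg[OF w] d \<open>c > 0\<close> by simp
          next
            case False
            have "w - q \<le> w powr \<alpha> / c"
              unfolding c_def using elim by (intro excess_le_powr \<alpha> w) (auto simp: k_def)
            also have "\<dots> = (1 - d) * w powr \<alpha> / ((1 - d) * c)"
              using d by simp
            also have "\<dots> \<le> \<phi> w / ((1 - d) * c)"
              using False elim d \<open>c > 0\<close> by (intro divide_right_mono Q) auto
            finally show ?thesis
              using False by simp
          qed
        qed
      qed (use F int_\<phi> in \<open>auto intro: integrable_excess\<close>)
      also have "\<dots> = (m\<alpha> - m1 powr \<alpha>) / ((1 - d) * c)"
        using val_\<phi> by simp
      finally show "expected_excess F q \<le> (m\<alpha> - m1 powr \<alpha>) / ((1 - d) * c)" .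
    qed
    then have "worst_case_excess \<alpha> m1 m\<alpha> q * q powr (\<alpha> - 1)
      \<le> (m\<alpha> - m1 powr \<alpha>) / ((1 - d) * c) * q powr (\<alpha> - 1)"
      by (rule mult_right_mono) simp
    also have "c = \<alpha> * (k powr (\<alpha> - 1) * q powr (\<alpha> - 1))"
      using \<open>k > 1\<close> elim by (simp add: c_def powr_mult)
    also have "(m\<alpha> - m1 powr \<alpha>) / ((1 - d) * (\<alpha> * (k powr (\<alpha> - 1) * q powr (\<alpha> - 1)))) * q powr (\<alpha> - 1)
      = tail_const / (1 - d)"
      using elim unfolding tail_const_def k_def[symmetric] by (simp add: mult_ac)
    finally show ?case .
  qed
qed

lemma tail_const_pos: "tail_const > 0"
  using \<alpha> m\<alpha> by (simp add: tail_const_def)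

lemma worst_case_excess_tail:
  "((\<lambda>q. worst_case_excess \<alpha> m1 m\<alpha> q * q powr (\<alpha> - 1)) \<longlongrightarrow> tail_const) at_top"
proof (rule order_tendstoI)
  fix l assume "l < tail_const"
  with worst_case_excess_lower
  show "\<forall>\<^sub>F q in at_top. l < worst_case_excess \<alpha> m1 m\<alpha> q * q powr (\<alpha> - 1)"
    by (auto elim: eventually_mono)
next
  fix u assume u: "tail_const < u"
  \<comment> \<open>Then \<open>1 - d\<close> is the midpoint of \<open>tail_const / u\<close> and
    \<open>1\<close>, hence exceeds \<open>tail_const / u\<close>.\<close>
  define d where "d = (1 - tail_const / u) / 2"
  have d: "0 < d" "d < 1" and "tail_const / (1 - d) < u"
    using u tail_const_pos by (auto simp: d_def field_simps)
  with worst_case_excess_upper[OF d]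
  show "\<forall>\<^sub>F q in at_top. worst_case_excess \<alpha> m1 m\<alpha> q * q powr (\<alpha> - 1) < u"
    by (auto elim: eventually_mono)
qed

lemma worst_case_excess_tendsto_0: "(worst_case_excess \<alpha> m1 m\<alpha> \<longlongrightarrow> 0) at_top"
  using worst_case_excess_tail \<alpha> by (intro tendsto_0_if_powr_tail[where \<beta> = "\<alpha> - 1"]) auto

text \<open>Existence and uniqueness together make the definite description meaningful.\<close>

lemma is_worst_case_distribution_worst_case:
  "is_worst_case_distribution \<alpha> m1 m\<alpha> (worst_case_distribution \<alpha> m1 m\<alpha>)"
proof -
  have "\<exists>F. is_worst_case_distribution \<alpha> m1 m\<alpha> F"
    unfolding is_worst_case_distribution_def
    by (rule exists_distribution_with_excess[OF worst_case_excess_convex worst_case_excess_antimono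
          worst_case_excess_lipschitz worst_case_excess_tendsto_0])
  moreover have "F = G"
    if "is_worst_case_distribution \<alpha> m1 m\<alpha> F" "is_worst_case_distribution \<alpha> m1 m\<alpha> G" for F G
    using that unfolding is_worst_case_distribution_def by (intro nonneg_distribution_eqI) auto
  ultimately have "\<exists>!F. is_worst_case_distribution \<alpha> m1 m\<alpha> F"
    by blast
  then show ?thesis
    unfolding worst_case_distribution_def by (rule theI')
qed

end

section \<open>Both claims about the robust minimizers\<close>

theorem proposition4p1:
  fixes \<alpha> m1 m\<alpha> :: real and q :: "real \<Rightarrow> real"
  assumes "\<alpha> > 1" and "m1 > 0" and "m\<alpha> > m1 powr \<alpha>"
    and "\<And>\<eta>. \<eta> \<in> {0<..<1} \<Longrightarrow> is_arg_min (robust_cost \<alpha> m1 m\<alpha> \<eta>) (\<lambda>x. x \<ge> 0) (q \<eta>)"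
  shows "(\<forall>\<eta>\<in>{0<..<1}.
            is_arg_min (newsvendor_cost (worst_case_distribution \<alpha> m1 m\<alpha>) \<eta>) (\<lambda>x. x \<ge> 0) (q \<eta>))
       \<and> q \<sim>[at_left 1]
           (\<lambda>\<eta>. (\<alpha> - 1) / \<alpha> * (1 / (1 - \<eta>)) * robust_optimal_value \<alpha> m1 m\<alpha> \<eta>)"
proof
  note params = assms(1-3)
  define P where "P = worst_case_excess \<alpha> m1 m\<alpha>"
  have cost: "robust_cost \<alpha> m1 m\<alpha> \<eta> x = (1 - \<eta>) * x + P x" for \<eta> x
    by (simp add: robust_cost_def P_def)
  \<comment> \<open>Agreement on \<open>x \<ge> 0\<close> suffices, since both minimizations are
    restricted to that set.\<close>
  have "newsvendor_cost (worst_case_distribution \<alpha> m1 m\<alpha>) \<eta> x = robust_cost \<alpha> m1 m\<alpha> \<eta> x"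
    if "x \<ge> 0" for \<eta> x
    using that is_worst_case_distribution_worst_case[OF params]
    by (simp add: is_worst_case_distribution_def newsvendor_cost_def robust_cost_def)
  then show "\<forall>\<eta>\<in>{0<..<1}.
      is_arg_min (newsvendor_cost (worst_case_distribution \<alpha> m1 m\<alpha>) \<eta>) (\<lambda>x. x \<ge> 0) (q \<eta>)"
    using assms(4) by (simp add: is_arg_min_def)
  have q_nonneg: "q \<eta> \<ge> 0" if "\<eta> \<in> {0<..<1}" for \<eta>
    using assms(4)[OF that] by (simp add: is_arg_min_def)
  have q_min: "(1 - \<eta>) * q \<eta> + P (q \<eta>) \<le> (1 - \<eta>) * x + P x"
    if "\<eta> \<in> {0<..<1}" "x \<ge> 0" for \<eta> x
    using assms(4)[OF that(1)] that(2) by (auto simp: is_arg_min_def cost not_less)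
  have opt_value: "robust_optimal_value \<alpha> m1 m\<alpha> \<eta> = (1 - \<eta>) * q \<eta> + P (q \<eta>)"
    if "\<eta> \<in> {0<..<1}" for \<eta>
    unfolding robust_optimal_value_def cost using q_min[OF that] q_nonneg[OF that]
    by (intro cInf_eq_minimum) auto
  have anti: "P y \<le> P x" if "0 \<le> x" "x \<le> y" for x y
    unfolding P_def using worst_case_excess_antimono[OF params that] .
  have beta: "\<alpha> - 1 > 0"
    using params by simp
  note tail = tail_const_pos[OF params] worst_case_excess_tail[OF params, folded P_def]
  define r where "r \<eta> = (1 - \<eta>) * q \<eta> / P (q \<eta>)" for \<eta>
  have r: "(r \<longlongrightarrow> \<alpha> - 1) (at_left 1)"
    unfolding r_def by (rule minimizer_ratio[OF anti beta tail q_nonneg q_min])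
  have pos: "P x > 0" if "x \<ge> 0" for x
    by (rule minimizer_profile_pos[OF anti beta tail q_nonneg q_min that])
  \<comment> \<open>With \<open>v = (1 - \<eta>) * q \<eta>\<close> the quotient of the two sides is
    \<open>\<alpha> / (\<alpha> - 1) * (v / (v + P (q \<eta>)))\<close>, and the last factor equals
    \<open>r \<eta> / (r \<eta> + 1)\<close>.\<close>
  have "((\<lambda>\<eta>. \<alpha> / (\<alpha> - 1) * (r \<eta> / (r \<eta> + 1))) \<longlongrightarrow> \<alpha> / (\<alpha> - 1) * ((\<alpha> - 1) / (\<alpha> - 1 + 1))) (at_left 1)"
    using params by (intro tendsto_intros r) auto
  also have "\<alpha> / (\<alpha> - 1) * ((\<alpha> - 1) / (\<alpha> - 1 + 1)) = 1"
    using params by simp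
  finally have lim: "((\<lambda>\<eta>. \<alpha> / (\<alpha> - 1) * (r \<eta> / (r \<eta> + 1))) \<longlongrightarrow> 1) (at_left 1)" .
  have "\<forall>\<^sub>F \<eta> in at_left 1. \<eta> \<in> {0<..<1::real}"
    by (auto simp: eventually_at_left_field intro!: exI[of _ 0])
  then have "\<forall>\<^sub>F \<eta> in at_left 1. \<alpha> / (\<alpha> - 1) * (r \<eta> / (r \<eta> + 1))
    = q \<eta> / ((\<alpha> - 1) / \<alpha> * (1 / (1 - \<eta>)) * robust_optimal_value \<alpha> m1 m\<alpha> \<eta>)"
  proof eventually_elim
    case (elim \<eta>)
    define v where "v = (1 - \<eta>) * q \<eta>"
    have "P (q \<eta>) > 0" "v \<ge> 0"
      using pos q_nonneg[OF elim] elim by (auto simp: v_def)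
    have "r \<eta> / (r \<eta> + 1) = v / (v + P (q \<eta>))"
    proof -
      have "r \<eta> = v / P (q \<eta>)" "r \<eta> + 1 = (v + P (q \<eta>)) / P (q \<eta>)"
        using \<open>P (q \<eta>) > 0\<close> by (simp_all add: r_def v_def add_divide_distrib)
      then show ?thesis
        using \<open>P (q \<eta>) > 0\<close> by simp
    qed
    then show ?case
      unfolding opt_value[OF elim] using elim params by (simp add: v_def)
  qed
  with lim show "q \<sim>[at_left 1]
      (\<lambda>\<eta>. (\<alpha> - 1) / \<alpha> * (1 / (1 - \<eta>)) * robust_optimal_value \<alpha> m1 m\<alpha> \<eta>)"
    by (intro asymp_equivI') (simp add: tendsto_cong)
qed

end
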